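(* Let $\Lambda$ be an Artin algebra, $M$ a $\Lambda$-module, $g:Q\to M$ a projective cover, and $P_1\xrightarrow{f}P_0\xrightarrow{\sigma}M\to 0$ a minimal projective presentation of $M$. Let $g':Q\to P_0$ be a lifting of $g$, i.e. $\sigma g'=g$. Then $$\left([0\ \ 1],\ \sigma\right):\left(P_1\oplus Q\xrightarrow{[f\ \ g']}P_0\right)\to\left(Q\xrightarrow{g}M\right)$$ is a minimal right $\mathcal{P}(\Lambda)$-approximation.
   Context: $\mathrm{mod}\text{-}\Lambda$ is the category of finitely generated $\Lambda$-modules; modules are finitely generated. $\mathcal{H}(\Lambda)$ is the morphism category of $\mathrm{mod}\text{-}\Lambda$: objects are morphisms $f:X\to Y$ in $\mathrm{mod}\text{-}\Lambda$, and a morphism from $(X\xrightarrow{f}Y)$ to $(X'\xrightarrow{f'}Y')$ is a pair $(\sigma_1,\sigma_2)$ with $\sigma_1:X\to X'$, $\sigma_2:Y\to Y'$ and $\sigma_2f=f'\sigma_1$. $\mathcal{P}(\Lambda)$ is the full subcategory of $\mathcal{H}(\Lambda)$ of objects $(P\xrightarrow{f}Q)$ with $P,Q$ projective. A right $\mathcal{P}(\Lambda)$-approximation of an object $\mathrm{X}$ is a morphism $\theta:\mathrm{P}\to\mathrm{X}$ with $\mathrm{P}\in\mathcal{P}(\Lambda)$ through which every morphism from an object of $\mathcal{P}(\Lambda)$ to $\mathrm{X}$ factors; it is minimal if every endomorphism $\gamma$ of $\mathrm{P}$ with $\theta\gamma=\theta$ is an automorphism. *)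

theory Defs
  imports "HOL-Algebra.Module" "HOL-Algebra.Ideal"
begin

section \<open>Artin algebras\<close>

definition artinian_ring :: "('k, 'x) ring_scheme \<Rightarrow> bool" where
  "artinian_ring R \<longleftrightarrow> ring R \<and>
     (\<forall>I :: nat \<Rightarrow> 'k set. (\<forall>n. ideal (I n) R \<and> I (Suc n) \<subseteq> I n) \<longrightarrow> (\<exists>N. \<forall>n\<ge>N. I n = I N))"
  \<comment> \<open>Only used for commutative \<open>R\<close>, where the two-sided ideals of \<^const>\<open>ideal\<close> are all the ideals.\<close>

text \<open>
  The library locale \<^locale>\<open>algebra\<close> covers commutative algebras only, so the two
  compatibility laws between scalars and multiplication are spelled out here.
\<close>

locale artin_algebra = module R \<Lambda> + ring \<Lambda>
  for R :: "('k, 'x) ring_scheme" and \<Lambda> :: "('k, 'r, 'y) module_scheme" +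
  assumes artinian: "artinian_ring R"
    and smult_mult_left: "\<lbrakk>c \<in> carrier R; a \<in> carrier \<Lambda>; b \<in> carrier \<Lambda>\<rbrakk> \<Longrightarrow>
      (c \<odot>\<^bsub>\<Lambda>\<^esub> a) \<otimes>\<^bsub>\<Lambda>\<^esub> b = c \<odot>\<^bsub>\<Lambda>\<^esub> (a \<otimes>\<^bsub>\<Lambda>\<^esub> b)"
    and smult_mult_right: "\<lbrakk>c \<in> carrier R; a \<in> carrier \<Lambda>; b \<in> carrier \<Lambda>\<rbrakk> \<Longrightarrow>
      a \<otimes>\<^bsub>\<Lambda>\<^esub> (c \<odot>\<^bsub>\<Lambda>\<^esub> b) = c \<odot>\<^bsub>\<Lambda>\<^esub> (a \<otimes>\<^bsub>\<Lambda>\<^esub> b)"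
    and finite_over_base: "\<exists>A. finite A \<and> A \<subseteq> carrier \<Lambda> \<and>
      (\<forall>x \<in> carrier \<Lambda>. \<exists>c \<in> A \<rightarrow> carrier R. x = (\<Oplus>\<^bsub>\<Lambda>\<^esub>a\<in>A. c a \<odot>\<^bsub>\<Lambda>\<^esub> a))"


section \<open>Finitely generated right modules\<close>

text \<open>
  As in the library's record \<^typ>\<open>('a, 'b) module\<close>, the ring record supplies the additive
  group; its fields \<^const>\<open>mult\<close> and \<^const>\<open>one\<close> carry no meaning.
\<close>

record ('m, 'r) rmodule = "'m ring" +
  rsmult :: "['m, 'r] \<Rightarrow> 'm" (infixl \<open>\<triangleleft>\<index>\<close> 70)

locale right_module = L?: ring \<Lambda> + M?: abelian_group M
  for \<Lambda> :: "('r, 'y) ring_scheme" and M :: "('m, 'r) rmodule" +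
  assumes rsmult_closed: "\<lbrakk>x \<in> carrier M; a \<in> carrier \<Lambda>\<rbrakk> \<Longrightarrow> x \<triangleleft>\<^bsub>M\<^esub> a \<in> carrier M"
    and rsmult_l_distr: "\<lbrakk>x \<in> carrier M; y \<in> carrier M; a \<in> carrier \<Lambda>\<rbrakk> \<Longrightarrow>
      (x \<oplus>\<^bsub>M\<^esub> y) \<triangleleft>\<^bsub>M\<^esub> a = x \<triangleleft>\<^bsub>M\<^esub> a \<oplus>\<^bsub>M\<^esub> y \<triangleleft>\<^bsub>M\<^esub> a"
    and rsmult_r_distr: "\<lbrakk>x \<in> carrier M; a \<in> carrier \<Lambda>; b \<in> carrier \<Lambda>\<rbrakk> \<Longrightarrow>
      x \<triangleleft>\<^bsub>M\<^esub> (a \<oplus>\<^bsub>\<Lambda>\<^esub> b) = x \<triangleleft>\<^bsub>M\<^esub> a \<oplus>\<^bsub>M\<^esub> x \<triangleleft>\<^bsub>M\<^esub> b"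
    and rsmult_assoc: "\<lbrakk>x \<in> carrier M; a \<in> carrier \<Lambda>; b \<in> carrier \<Lambda>\<rbrakk> \<Longrightarrow>
      x \<triangleleft>\<^bsub>M\<^esub> (a \<otimes>\<^bsub>\<Lambda>\<^esub> b) = (x \<triangleleft>\<^bsub>M\<^esub> a) \<triangleleft>\<^bsub>M\<^esub> b"
    and rsmult_one: "x \<in> carrier M \<Longrightarrow> x \<triangleleft>\<^bsub>M\<^esub> \<one>\<^bsub>\<Lambda>\<^esub> = x"

definition fg_module :: "('r, 'y) ring_scheme \<Rightarrow> ('m, 'r) rmodule \<Rightarrow> bool" where
  "fg_module \<Lambda> M \<longleftrightarrow> right_module \<Lambda> M \<and>
     (\<exists>A. finite A \<and> A \<subseteq> carrier M \<and>
       (\<forall>x \<in> carrier M. \<exists>c \<in> A \<rightarrow> carrier \<Lambda>. x = (\<Oplus>\<^bsub>M\<^esub>a\<in>A. a \<triangleleft>\<^bsub>M\<^esub> c a)))"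

text \<open>
  Homomorphisms are HOL functions, of which only the values on the carrier matter;
  equality of homomorphisms is therefore always stated on the carrier.
\<close>

definition rhom ::
    "('r, 'y) ring_scheme \<Rightarrow> ('m, 'r) rmodule \<Rightarrow> ('n, 'r) rmodule \<Rightarrow> ('m \<Rightarrow> 'n) set" where
  "rhom \<Lambda> M N = {h \<in> carrier M \<rightarrow> carrier N.
     (\<forall>x \<in> carrier M. \<forall>y \<in> carrier M. h (x \<oplus>\<^bsub>M\<^esub> y) = h x \<oplus>\<^bsub>N\<^esub> h y) \<and>
     (\<forall>x \<in> carrier M. \<forall>a \<in> carrier \<Lambda>. h (x \<triangleleft>\<^bsub>M\<^esub> a) = h x \<triangleleft>\<^bsub>N\<^esub> a)}"

definition rsubmodule :: "('r, 'y) ring_scheme \<Rightarrow> 'm set \<Rightarrow> ('m, 'r) rmodule \<Rightarrow> bool" where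
  "rsubmodule \<Lambda> H M \<longleftrightarrow> subgroup H (add_monoid M) \<and>
     (\<forall>x \<in> H. \<forall>a \<in> carrier \<Lambda>. x \<triangleleft>\<^bsub>M\<^esub> a \<in> H)"

definition rker :: "('m, 'r) rmodule \<Rightarrow> ('n, 'r) rmodule \<Rightarrow> ('m \<Rightarrow> 'n) \<Rightarrow> 'm set" where
  "rker M N h = {x \<in> carrier M. h x = \<zero>\<^bsub>N\<^esub>}"

definition direct_sum ::
    "('m, 'r) rmodule \<Rightarrow> ('n, 'r) rmodule \<Rightarrow> ('m \<times> 'n, 'r) rmodule" (infixr \<open>\<oplus>\<^sub>M\<close> 65) where
  "M \<oplus>\<^sub>M N = \<lparr>carrier = carrier M \<times> carrier N, mult = undefined, one = undefined,
     zero = (\<zero>\<^bsub>M\<^esub>, \<zero>\<^bsub>N\<^esub>),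
     add = (\<lambda>(x, y) (x', y'). (x \<oplus>\<^bsub>M\<^esub> x', y \<oplus>\<^bsub>N\<^esub> y')),
     rsmult = (\<lambda>(x, y) a. (x \<triangleleft>\<^bsub>M\<^esub> a, y \<triangleleft>\<^bsub>N\<^esub> a))\<rparr>"

definition row :: "('l, 'r) rmodule \<Rightarrow> ('m \<Rightarrow> 'l) \<Rightarrow> ('n \<Rightarrow> 'l) \<Rightarrow> 'm \<times> 'n \<Rightarrow> 'l" where
  "row L u v = (\<lambda>(x, y). u x \<oplus>\<^bsub>L\<^esub> v y)"
  \<comment> \<open>the map \<open>[u v]\<close> from a direct sum to \<open>L\<close>\<close>


section \<open>Projective modules, projective covers and minimal presentations\<close>

text \<open>
  HOL does not allow quantification over types inside a definition. Projectivity is therefore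
  tested on the finitely generated modules with carrier in the type \<open>(nat \<Rightarrow> 'r) set\<close>. This is
  no restriction: every finitely generated module is isomorphic to one of these
  (\<open>fg_module_in_universe\<close>), so the lifting property holds for finitely generated modules over
  arbitrary types (\<open>projective_lifting\<close>).
\<close>

definition projective :: "('r, 'y) ring_scheme \<Rightarrow> ('m, 'r) rmodule \<Rightarrow> bool" where
  "projective \<Lambda> P \<longleftrightarrow> fg_module \<Lambda> P \<and>
     (\<forall>(N :: ((nat \<Rightarrow> 'r) set, 'r) rmodule) (L :: ((nat \<Rightarrow> 'r) set, 'r) rmodule) p h.
        fg_module \<Lambda> N \<longrightarrow> fg_module \<Lambda> L \<longrightarrow>
        p \<in> rhom \<Lambda> N L \<longrightarrow> p ` carrier N = carrier L \<longrightarrow> h \<in> rhom \<Lambda> P L \<longrightarrow>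
        (\<exists>k \<in> rhom \<Lambda> P N. \<forall>x \<in> carrier P. p (k x) = h x))"

definition superfluous :: "('r, 'y) ring_scheme \<Rightarrow> 'm set \<Rightarrow> ('m, 'r) rmodule \<Rightarrow> bool" where
  "superfluous \<Lambda> K M \<longleftrightarrow> rsubmodule \<Lambda> K M \<and>
     (\<forall>H. rsubmodule \<Lambda> H M \<longrightarrow> K <+>\<^bsub>M\<^esub> H = carrier M \<longrightarrow> H = carrier M)"

definition projective_cover ::
    "('r, 'y) ring_scheme \<Rightarrow> ('p, 'r) rmodule \<Rightarrow> ('p \<Rightarrow> 'm) \<Rightarrow> ('m, 'r) rmodule \<Rightarrow> bool" where
  "projective_cover \<Lambda> P g M \<longleftrightarrow> projective \<Lambda> P \<and> fg_module \<Lambda> M \<and> g \<in> rhom \<Lambda> P M \<and>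
     g ` carrier P = carrier M \<and> superfluous \<Lambda> (rker P M g) P"

definition minimal_projective_presentation ::
    "('r, 'y) ring_scheme \<Rightarrow> ('p1, 'r) rmodule \<Rightarrow> ('p1 \<Rightarrow> 'p0) \<Rightarrow> ('p0, 'r) rmodule \<Rightarrow>
     ('p0 \<Rightarrow> 'm) \<Rightarrow> ('m, 'r) rmodule \<Rightarrow> bool" where
  "minimal_projective_presentation \<Lambda> P1 f P0 \<sigma> M \<longleftrightarrow>
     projective_cover \<Lambda> P0 \<sigma> M \<and>
     f ` carrier P1 = rker P0 M \<sigma> \<and>
     projective_cover \<Lambda> P1 f (P0\<lparr>carrier := rker P0 M \<sigma>\<rparr>)"


section \<open>The morphism category and right approximations\<close>

record ('a, 'b, 'r) arrow =
  src :: "('a, 'r) rmodule"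
  tgt :: "('b, 'r) rmodule"
  arr :: "'a \<Rightarrow> 'b"

definition H_obj :: "('r, 'y) ring_scheme \<Rightarrow> ('a, 'b, 'r) arrow \<Rightarrow> bool" where
  "H_obj \<Lambda> X \<longleftrightarrow> fg_module \<Lambda> (src X) \<and> fg_module \<Lambda> (tgt X) \<and> arr X \<in> rhom \<Lambda> (src X) (tgt X)"

definition H_hom :: "('r, 'y) ring_scheme \<Rightarrow> ('a, 'b, 'r) arrow \<Rightarrow> ('c, 'd, 'r) arrow \<Rightarrow>
    (('a \<Rightarrow> 'c) \<times> ('b \<Rightarrow> 'd)) set" where
  "H_hom \<Lambda> X Y = {(s, t). s \<in> rhom \<Lambda> (src X) (src Y) \<and> t \<in> rhom \<Lambda> (tgt X) (tgt Y) \<and>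
     (\<forall>x \<in> carrier (src X). t (arr X x) = arr Y (s x))}"

definition H_comp :: "('c \<Rightarrow> 'e) \<times> ('d \<Rightarrow> 'f) \<Rightarrow> ('a \<Rightarrow> 'c) \<times> ('b \<Rightarrow> 'd) \<Rightarrow>
    ('a \<Rightarrow> 'e) \<times> ('b \<Rightarrow> 'f)" (infixr \<open>\<circ>\<^sub>H\<close> 55) where
  "\<theta> \<circ>\<^sub>H \<phi> = (fst \<theta> \<circ> fst \<phi>, snd \<theta> \<circ> snd \<phi>)"

definition H_id :: "('a \<Rightarrow> 'a) \<times> ('b \<Rightarrow> 'b)" where
  "H_id = (id, id)"

definition H_eq :: "('a, 'b, 'r) arrow \<Rightarrow> ('a \<Rightarrow> 'c) \<times> ('b \<Rightarrow> 'd) \<Rightarrow>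
    ('a \<Rightarrow> 'c) \<times> ('b \<Rightarrow> 'd) \<Rightarrow> bool" where
  "H_eq X \<phi> \<psi> \<longleftrightarrow> (\<forall>x \<in> carrier (src X). fst \<phi> x = fst \<psi> x) \<and>
     (\<forall>y \<in> carrier (tgt X). snd \<phi> y = snd \<psi> y)"
  \<comment> \<open>equality of two morphisms with domain \<open>X\<close>\<close>

definition H_automorphism :: "('r, 'y) ring_scheme \<Rightarrow> ('a, 'b, 'r) arrow \<Rightarrow>
    ('a \<Rightarrow> 'a) \<times> ('b \<Rightarrow> 'b) \<Rightarrow> bool" where
  "H_automorphism \<Lambda> X \<gamma> \<longleftrightarrow> \<gamma> \<in> H_hom \<Lambda> X X \<and>
     (\<exists>\<delta> \<in> H_hom \<Lambda> X X. H_eq X (\<gamma> \<circ>\<^sub>H \<delta>) H_id \<and> H_eq X (\<delta> \<circ>\<^sub>H \<gamma>) H_id)"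

definition P_obj :: "('r, 'y) ring_scheme \<Rightarrow> ('a, 'b, 'r) arrow \<Rightarrow> bool" where
  "P_obj \<Lambda> X \<longleftrightarrow> H_obj \<Lambda> X \<and> projective \<Lambda> (src X) \<and> projective \<Lambda> (tgt X)"

text \<open>
  The two type arguments are the carrier types of the test objects. Quantification over all
  objects of \<open>\<P>(\<Lambda>)\<close> is expressed by leaving them arbitrary in a theorem.
\<close>

definition right_P_approximation ::
    "'u itself \<Rightarrow> 'v itself \<Rightarrow> ('r, 'y) ring_scheme \<Rightarrow> ('a, 'b, 'r) arrow \<Rightarrow>
     ('a \<Rightarrow> 'c) \<times> ('b \<Rightarrow> 'd) \<Rightarrow> ('c, 'd, 'r) arrow \<Rightarrow> bool" where
  "right_P_approximation _ _ \<Lambda> P \<theta> X \<longleftrightarrow> H_obj \<Lambda> X \<and> P_obj \<Lambda> P \<and> \<theta> \<in> H_hom \<Lambda> P X \<and>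
     (\<forall>(P' :: ('u, 'v, 'r) arrow). P_obj \<Lambda> P' \<longrightarrow>
        (\<forall>\<phi> \<in> H_hom \<Lambda> P' X. \<exists>\<psi> \<in> H_hom \<Lambda> P' P. H_eq P' (\<theta> \<circ>\<^sub>H \<psi>) \<phi>))"

definition minimal_right_P_approximation ::
    "'u itself \<Rightarrow> 'v itself \<Rightarrow> ('r, 'y) ring_scheme \<Rightarrow> ('a, 'b, 'r) arrow \<Rightarrow>
     ('a \<Rightarrow> 'c) \<times> ('b \<Rightarrow> 'd) \<Rightarrow> ('c, 'd, 'r) arrow \<Rightarrow> bool" where
  "minimal_right_P_approximation U V \<Lambda> P \<theta> X \<longleftrightarrow> right_P_approximation U V \<Lambda> P \<theta> X \<and>
     (\<forall>\<gamma> \<in> H_hom \<Lambda> P P. H_eq P (\<theta> \<circ>\<^sub>H \<gamma>) \<theta> \<longrightarrow> H_automorphism \<Lambda> P \<gamma>)"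


section \<open>Independence of the universe\<close>

lemma rhom_finsum:
  assumes "right_module \<Lambda> M" "right_module \<Lambda> N" "h \<in> rhom \<Lambda> M N"
    and "finite A" "f \<in> A \<rightarrow> carrier M"
  shows "h (\<Oplus>\<^bsub>M\<^esub>a\<in>A. f a) = (\<Oplus>\<^bsub>N\<^esub>a\<in>A. h (f a))"
proof -
  interpret M: right_module \<Lambda> M by fact
  interpret N: right_module \<Lambda> N by fact
  have h: "h x \<in> carrier N" "h (x \<oplus>\<^bsub>M\<^esub> y) = h x \<oplus>\<^bsub>N\<^esub> h y"
    if "x \<in> carrier M" "y \<in> carrier M" for x y
    using assms(3) that by (auto simp: rhom_def)
  have "h \<zero>\<^bsub>M\<^esub> \<oplus>\<^bsub>N\<^esub> h \<zero>\<^bsub>M\<^esub> = h \<zero>\<^bsub>M\<^esub>"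
    using h(2)[of "\<zero>\<^bsub>M\<^esub>" "\<zero>\<^bsub>M\<^esub>"] by simp
  then have h0: "h \<zero>\<^bsub>M\<^esub> = \<zero>\<^bsub>N\<^esub>"
    using h(1) N.M.add.r_cancel_one[of "h \<zero>\<^bsub>M\<^esub>" "h \<zero>\<^bsub>M\<^esub>"] by auto
  from assms(4,5) show ?thesis
  proof (induction A rule: finite_induct)
    case empty
    then show ?case by (simp add: h0)
  next
    case (insert a A)
    then have "f \<in> A \<rightarrow> carrier M" "f a \<in> carrier M" by auto
    moreover have "(\<lambda>a. h (f a)) \<in> A \<rightarrow> carrier N" using insert.prems h(1) by auto
    ultimately show ?case using insert h by (simp add: M.M.finsum_insert N.M.finsum_insert)
  qed
qed

lemma fg_module_in_universe:
  fixes \<Lambda> :: "('r, 'y) ring_scheme" and M :: "('m, 'r) rmodule"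
  assumes "fg_module \<Lambda> M"
  shows "\<exists>(N :: ((nat \<Rightarrow> 'r) set, 'r) rmodule) h k.
    fg_module \<Lambda> N \<and> h \<in> rhom \<Lambda> M N \<and> k \<in> rhom \<Lambda> N M \<and>
    (\<forall>x \<in> carrier M. k (h x) = x) \<and> (\<forall>y \<in> carrier N. h (k y) = y)"
proof -
  interpret M: right_module \<Lambda> M using assms by (simp add: fg_module_def)
  obtain A where A: "finite A" "A \<subseteq> carrier M"
    and gen: "\<And>x. x \<in> carrier M \<Longrightarrow> \<exists>c \<in> A \<rightarrow> carrier \<Lambda>. x = (\<Oplus>\<^bsub>M\<^esub>a\<in>A. a \<triangleleft>\<^bsub>M\<^esub> c a)"
    using assms unfolding fg_module_def by blast
  obtain e :: "'m \<Rightarrow> nat" where e: "inj_on e A"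
    using finite_imp_inj_to_nat_seg[OF A(1)] by blast
  define h :: "'m \<Rightarrow> (nat \<Rightarrow> 'r) set" where
    "h x = {c. (\<forall>a\<in>A. c (e a) \<in> carrier \<Lambda>) \<and> x = (\<Oplus>\<^bsub>M\<^esub>a\<in>A. a \<triangleleft>\<^bsub>M\<^esub> c (e a))}" for x
  have ne: "h x \<noteq> {}" if x: "x \<in> carrier M" for x
  proof -
    obtain c where c: "c \<in> A \<rightarrow> carrier \<Lambda>" "x = (\<Oplus>\<^bsub>M\<^esub>a\<in>A. a \<triangleleft>\<^bsub>M\<^esub> c a)"
      using gen[OF x] by blast
    have inv: "the_inv_into A e (e a) = a" if "a \<in> A" for a
      using e that by (simp add: the_inv_into_f_f)
    have "(\<Oplus>\<^bsub>M\<^esub>a\<in>A. a \<triangleleft>\<^bsub>M\<^esub> c (the_inv_into A e (e a))) = (\<Oplus>\<^bsub>M\<^esub>a\<in>A. a \<triangleleft>\<^bsub>M\<^esub> c a)"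
      using c(1) A(2) by (intro M.M.finsum_cong') (auto simp: inv intro!: M.rsmult_closed)
    then have "(\<lambda>n. c (the_inv_into A e n)) \<in> h x"
      unfolding h_def using c by (auto simp: inv)
    then show ?thesis by blast
  qed
  have inj: "inj_on h (carrier M)"
  proof (rule inj_onI)
    fix x y assume "x \<in> carrier M" "y \<in> carrier M" "h x = h y"
    moreover from this(1) ne obtain c where "c \<in> h x" by blast
    ultimately have "c \<in> h x" "c \<in> h y" by auto
    then show "x = y" unfolding h_def by auto
  qed
  define k where "k = the_inv_into (carrier M) h"
  have kh: "k (h x) = x" if "x \<in> carrier M" for x
    using inj that by (simp add: k_def the_inv_into_f_f)
  define N :: "((nat \<Rightarrow> 'r) set, 'r) rmodule" where
    "N = \<lparr>carrier = h ` carrier M, mult = undefined, one = undefined, zero = h \<zero>\<^bsub>M\<^esub>,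
       add = (\<lambda>u v. h (k u \<oplus>\<^bsub>M\<^esub> k v)), rsmult = (\<lambda>u a. h (k u \<triangleleft>\<^bsub>M\<^esub> a))\<rparr>"
  have N: "carrier N = h ` carrier M" "\<zero>\<^bsub>N\<^esub> = h \<zero>\<^bsub>M\<^esub>"
    "\<And>u v. u \<oplus>\<^bsub>N\<^esub> v = h (k u \<oplus>\<^bsub>M\<^esub> k v)" "\<And>u a. u \<triangleleft>\<^bsub>N\<^esub> a = h (k u \<triangleleft>\<^bsub>M\<^esub> a)"
    by (simp_all add: N_def)
  have "abelian_group N"
  proof (rule abelian_groupI)
    fix u assume "u \<in> carrier N"
    then obtain x where "x \<in> carrier M" "u = h x" by (auto simp: N)
    then show "\<exists>v \<in> carrier N. v \<oplus>\<^bsub>N\<^esub> u = \<zero>\<^bsub>N\<^esub>"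
      by (intro bexI[of _ "h (\<ominus>\<^bsub>M\<^esub> x)"]) (auto simp: N kh M.M.l_neg)
  qed (auto simp: N kh M.M.add.m_ac)
  then have rN: "right_module \<Lambda> N"
    by (intro right_module.intro right_module_axioms.intro M.L.ring_axioms)
      (auto simp: N kh M.rsmult_closed M.rsmult_l_distr M.rsmult_r_distr M.rsmult_assoc
        M.rsmult_one)
  have hN: "h \<in> rhom \<Lambda> M N" by (auto simp: rhom_def N kh)
  have kN: "k \<in> rhom \<Lambda> N M" by (auto simp: rhom_def N kh M.rsmult_closed)
  interpret N: right_module \<Lambda> N by (rule rN)
  have "\<exists>c \<in> h ` A \<rightarrow> carrier \<Lambda>. u = (\<Oplus>\<^bsub>N\<^esub>b\<in>h ` A. b \<triangleleft>\<^bsub>N\<^esub> c b)" if "u \<in> carrier N" for u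
  proof -
    from that obtain x where x: "x \<in> carrier M" "u = h x" by (auto simp: N)
    obtain c where c: "c \<in> A \<rightarrow> carrier \<Lambda>" "x = (\<Oplus>\<^bsub>M\<^esub>a\<in>A. a \<triangleleft>\<^bsub>M\<^esub> c a)"
      using gen[OF x(1)] by blast
    have injA: "inj_on h A" using inj A(2) by (rule inj_on_subset)
    have kA: "k (h a) = a" if "a \<in> A" for a using kh A(2) that by blast
    have cl: "h a \<triangleleft>\<^bsub>N\<^esub> c a \<in> carrier N" if "a \<in> A" for a
      using that A(2) c(1) by (intro N.rsmult_closed) (auto simp: N(1))
    have "(\<Oplus>\<^bsub>N\<^esub>b\<in>h ` A. b \<triangleleft>\<^bsub>N\<^esub> c (k b)) = (\<Oplus>\<^bsub>N\<^esub>a\<in>A. h a \<triangleleft>\<^bsub>N\<^esub> c (k (h a)))"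
      by (rule N.M.finsum_reindex) (use cl injA kA in auto)
    also have "\<dots> = (\<Oplus>\<^bsub>N\<^esub>a\<in>A. h (a \<triangleleft>\<^bsub>M\<^esub> c a))"
    proof (rule N.M.finsum_cong')
      show "(\<lambda>a. h (a \<triangleleft>\<^bsub>M\<^esub> c a)) \<in> A \<rightarrow> carrier N"
        using A(2) c(1) by (auto simp: N(1) intro!: imageI M.rsmult_closed)
    qed (use kA in \<open>auto simp: N\<close>)
    also have "\<dots> = u"
      unfolding x(2) c(2) using A c(1)
      by (intro rhom_finsum[OF M.right_module_axioms rN hN, symmetric])
        (auto intro!: M.rsmult_closed)
    finally show ?thesis
      using c(1) kA by (intro bexI[of _ "\<lambda>b. c (k b)"]) auto
  qed
  then have "fg_module \<Lambda> N"
    unfolding fg_module_def using rN A by (intro conjI exI[of _ "h ` A"]) (auto simp: N(1))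
  moreover have "h (k y) = y" if "y \<in> carrier N" for y using that kh by (auto simp: N)
  ultimately show ?thesis using hN kN kh by (intro exI[of _ N] exI[of _ h] exI[of _ k]) simp
qed

lemma rhom_compose:
  "\<lbrakk>h \<in> rhom \<Lambda> M N; k \<in> rhom \<Lambda> N L\<rbrakk> \<Longrightarrow> (\<lambda>x. k (h x)) \<in> rhom \<Lambda> M L"
  unfolding rhom_def Pi_iff mem_Collect_eq by metis

lemma projective_lifting:
  fixes \<Lambda> :: "('r, 'y) ring_scheme"
  assumes "projective \<Lambda> P" "fg_module \<Lambda> N" "fg_module \<Lambda> L"
    and p: "p \<in> rhom \<Lambda> N L" "p ` carrier N = carrier L" and h: "h \<in> rhom \<Lambda> P L"
  shows "\<exists>k \<in> rhom \<Lambda> P N. \<forall>x \<in> carrier P. p (k x) = h x"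
proof -
  from fg_module_in_universe[OF assms(2)]
  obtain N' :: "((nat \<Rightarrow> 'r) set, 'r) rmodule" and i j
    where "fg_module \<Lambda> N' \<and> i \<in> rhom \<Lambda> N N' \<and>
    j \<in> rhom \<Lambda> N' N \<and> (\<forall>x \<in> carrier N. j (i x) = x) \<and>
    (\<forall>y \<in> carrier N'. i (j y) = y)"
    by blast
  then have N': "fg_module \<Lambda> N'" "i \<in> rhom \<Lambda> N N'" "j \<in> rhom \<Lambda> N' N"
    "\<And>x. x \<in> carrier N \<Longrightarrow> j (i x) = x" "\<And>y. y \<in> carrier N' \<Longrightarrow> i (j y) = y"
    by simp_all
  from fg_module_in_universe[OF assms(3)]
  obtain L' :: "((nat \<Rightarrow> 'r) set, 'r) rmodule" and u v
    where "fg_module \<Lambda> L' \<and> u \<in> rhom \<Lambda> L L' \<and>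
    v \<in> rhom \<Lambda> L' L \<and> (\<forall>x \<in> carrier L. v (u x) = x) \<and>
    (\<forall>y \<in> carrier L'. u (v y) = y)"
    by blast
  then have L': "fg_module \<Lambda> L'" "u \<in> rhom \<Lambda> L L'" "v \<in> rhom \<Lambda> L' L"
    "\<And>x. x \<in> carrier L \<Longrightarrow> v (u x) = x" "\<And>y. y \<in> carrier L' \<Longrightarrow> u (v y) = y"
    by simp_all
  let ?p = "\<lambda>x. u (p (j x))" and ?h = "\<lambda>x. u (h x)"
  have hom: "?p \<in> rhom \<Lambda> N' L'" "?h \<in> rhom \<Lambda> P L'"
    by (rule rhom_compose[OF rhom_compose[OF N'(3) p(1)] L'(2)], rule rhom_compose[OF h L'(2)])
  have surj: "?p ` carrier N' = carrier L'"
  proof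
    show "?p ` carrier N' \<subseteq> carrier L'" using hom(1) by (auto simp: rhom_def)
    show "carrier L' \<subseteq> ?p ` carrier N'"
    proof
      fix y assume y: "y \<in> carrier L'"
      then have "v y \<in> carrier L" using L'(3) by (auto simp: rhom_def)
      then obtain x where x: "x \<in> carrier N" "v y = p x" using p(2) by auto
      then have "i x \<in> carrier N'" "y = ?p (i x)"
        using N'(2,4) L'(5)[OF y] by (auto simp: rhom_def)
      then show "y \<in> ?p ` carrier N'" by blast
    qed
  qed
  have "\<exists>k \<in> rhom \<Lambda> P N'. \<forall>x \<in> carrier P. ?p (k x) = ?h x"
    by (rule assms(1)[unfolded projective_def, THEN conjunct2, rule_format,
          OF N'(1) L'(1) hom(1) surj hom(2)])
  then obtain k where k: "k \<in> rhom \<Lambda> P N'" "\<And>x. x \<in> carrier P \<Longrightarrow> ?p (k x) = ?h x"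
    by (elim bexE) simp
  have "p (j (k x)) = h x" if x: "x \<in> carrier P" for x
  proof -
    have cl: "p (j (k x)) \<in> carrier L" "h x \<in> carrier L"
      using x k(1) N'(3) p(1) h by (auto simp: rhom_def Pi_iff)
    have "v (u (p (j (k x)))) = v (u (h x))" by (rule arg_cong[OF k(2)[OF x]])
    then show ?thesis unfolding L'(4)[OF cl(1)] L'(4)[OF cl(2)] .
  qed
  then show ?thesis by (intro bexI[OF _ rhom_compose[OF k(1) N'(3)]]) simp
qed

end

theory Submission
  imports Defs
begin

text \<open>
  Approximation: given \<open>(\<phi>\<^sub>1, \<phi>\<^sub>2)\<close> from \<open>a : A \<rightarrow> B\<close> with \<open>A\<close>, \<open>B\<close> projective, lift \<open>\<phi>\<^sub>2\<close> to
  \<open>\<psi>\<^sub>2 : B \<rightarrow> P\<^sub>0\<close>; then \<open>\<psi>\<^sub>2 a - g' \<phi>\<^sub>1\<close> lands in the kernel of \<open>\<sigma>\<close> and lifts to \<open>u : A \<rightarrow> P\<^sub>1\<close>, and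
  \<open>((u, \<phi>\<^sub>1), \<psi>\<^sub>2)\<close> is the required factorization.

  Minimality: an endomorphism \<open>(\<gamma>\<^sub>1, \<gamma>\<^sub>2)\<close> over \<open>(Q \<rightarrow> M)\<close> has \<open>\<sigma> \<gamma>\<^sub>2 = \<sigma>\<close>, so \<open>\<gamma>\<^sub>2\<close> is bijective and
  restricts to a bijection of the kernel of \<open>\<sigma>\<close>. Moreover \<open>\<gamma>\<^sub>1\<close> is triangular with diagonal \<open>\<alpha>\<close>, \<open>1\<close>,
  where \<open>f \<alpha> = \<gamma>\<^sub>2 f\<close>, so \<open>\<alpha>\<close> is bijective because \<open>f\<close> is a projective cover of that kernel.

  Both bijectivity claims hold for the same reason: an endomorphism of a projective cover that lies
  over a bijection is onto because the kernel is superfluous, hence splits, and the splitting also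
  lies over a bijection, so it is onto as well.
\<close>

section \<open>Homomorphisms of right modules\<close>

lemma rhom_closed: "\<lbrakk>h \<in> rhom \<Lambda> M N; x \<in> carrier M\<rbrakk> \<Longrightarrow> h x \<in> carrier N"
  by (auto simp: rhom_def)

lemma rhom_add:
  "\<lbrakk>h \<in> rhom \<Lambda> M N; x \<in> carrier M; y \<in> carrier M\<rbrakk> \<Longrightarrow> h (x \<oplus>\<^bsub>M\<^esub> y) = h x \<oplus>\<^bsub>N\<^esub> h y"
  by (auto simp: rhom_def)

lemma rhom_smult:
  "\<lbrakk>h \<in> rhom \<Lambda> M N; x \<in> carrier M; a \<in> carrier \<Lambda>\<rbrakk> \<Longrightarrow> h (x \<triangleleft>\<^bsub>M\<^esub> a) = h x \<triangleleft>\<^bsub>N\<^esub> a"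
  by (auto simp: rhom_def)

lemma rhomI:
  assumes "\<And>x. x \<in> carrier M \<Longrightarrow> h x \<in> carrier N"
    and "\<And>x y. \<lbrakk>x \<in> carrier M; y \<in> carrier M\<rbrakk> \<Longrightarrow> h (x \<oplus>\<^bsub>M\<^esub> y) = h x \<oplus>\<^bsub>N\<^esub> h y"
    and "\<And>x a. \<lbrakk>x \<in> carrier M; a \<in> carrier \<Lambda>\<rbrakk> \<Longrightarrow> h (x \<triangleleft>\<^bsub>M\<^esub> a) = h x \<triangleleft>\<^bsub>N\<^esub> a"
  shows "h \<in> rhom \<Lambda> M N"
  using assms by (auto simp: rhom_def)

lemma fg_right_module: "fg_module \<Lambda> M \<Longrightarrow> right_module \<Lambda> M"
  by (simp add: fg_module_def)

lemma projective_fg: "projective \<Lambda> P \<Longrightarrow> fg_module \<Lambda> P"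
  by (simp add: projective_def)

context right_module
begin

lemma rsmult_zero_left [simp]: "a \<in> carrier \<Lambda> \<Longrightarrow> \<zero>\<^bsub>M\<^esub> \<triangleleft>\<^bsub>M\<^esub> a = \<zero>\<^bsub>M\<^esub>"
  using rsmult_l_distr[of "\<zero>\<^bsub>M\<^esub>" "\<zero>\<^bsub>M\<^esub>" a] rsmult_closed[of "\<zero>\<^bsub>M\<^esub>" a]
  by (simp add: M.add.r_cancel_one)

lemma rsmult_minus_left:
  assumes "x \<in> carrier M" "a \<in> carrier \<Lambda>"
  shows "(\<ominus>\<^bsub>M\<^esub> x) \<triangleleft>\<^bsub>M\<^esub> a = \<ominus>\<^bsub>M\<^esub> (x \<triangleleft>\<^bsub>M\<^esub> a)"
proof (rule M.minus_equality[symmetric])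
  show "(\<ominus>\<^bsub>M\<^esub> x) \<triangleleft>\<^bsub>M\<^esub> a \<oplus>\<^bsub>M\<^esub> x \<triangleleft>\<^bsub>M\<^esub> a = \<zero>\<^bsub>M\<^esub>"
    using assms rsmult_l_distr[of "\<ominus>\<^bsub>M\<^esub> x" x a] by (simp add: M.l_neg)
qed (use assms rsmult_closed in auto)

lemma rhom_diff:
  assumes u: "u \<in> rhom \<Lambda> A M" and v: "v \<in> rhom \<Lambda> A M"
  shows "(\<lambda>x. u x \<ominus>\<^bsub>M\<^esub> v x) \<in> rhom \<Lambda> A M"
proof (rule rhomI)
  fix x y assume xy: "x \<in> carrier A" "y \<in> carrier A"
  then have "u x \<in> carrier M" "u y \<in> carrier M" "v x \<in> carrier M" "v y \<in> carrier M"
    by (simp_all add: rhom_closed[OF u] rhom_closed[OF v])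
  then show "u (x \<oplus>\<^bsub>A\<^esub> y) \<ominus>\<^bsub>M\<^esub> v (x \<oplus>\<^bsub>A\<^esub> y) = (u x \<ominus>\<^bsub>M\<^esub> v x) \<oplus>\<^bsub>M\<^esub> (u y \<ominus>\<^bsub>M\<^esub> v y)"
    using xy u v by (simp add: rhom_add M.minus_eq M.minus_add M.add.m_ac)
next
  fix x a assume "x \<in> carrier A" "a \<in> carrier \<Lambda>"
  then show "u (x \<triangleleft>\<^bsub>A\<^esub> a) \<ominus>\<^bsub>M\<^esub> v (x \<triangleleft>\<^bsub>A\<^esub> a) = (u x \<ominus>\<^bsub>M\<^esub> v x) \<triangleleft>\<^bsub>M\<^esub> a"
    using u v by (simp add: rhom_smult M.minus_eq rsmult_l_distr rsmult_minus_left rhom_closed)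
qed (simp add: rhom_closed[OF u] rhom_closed[OF v])

lemma rhom_row:
  assumes u: "u \<in> rhom \<Lambda> A M" and v: "v \<in> rhom \<Lambda> B M"
  shows "row M u v \<in> rhom \<Lambda> (A \<oplus>\<^sub>M B) M"
proof (rule rhomI)
  fix p q assume "p \<in> carrier (A \<oplus>\<^sub>M B)" "q \<in> carrier (A \<oplus>\<^sub>M B)"
  then show "row M u v (p \<oplus>\<^bsub>A \<oplus>\<^sub>M B\<^esub> q) = row M u v p \<oplus>\<^bsub>M\<^esub> row M u v q"
    by (auto simp: row_def direct_sum_def rhom_add[OF u] rhom_add[OF v] rhom_closed[OF u]
        rhom_closed[OF v] M.add.m_ac)
qed (auto simp: row_def direct_sum_def rhom_smult[OF u] rhom_smult[OF v] rhom_closed[OF u]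
    rhom_closed[OF v] rsmult_l_distr)

end

lemma rhom_zero:
  assumes "right_module \<Lambda> M" "right_module \<Lambda> N" "h \<in> rhom \<Lambda> M N"
  shows "h \<zero>\<^bsub>M\<^esub> = \<zero>\<^bsub>N\<^esub>"
proof -
  interpret M: right_module \<Lambda> M by fact
  interpret N: right_module \<Lambda> N by fact
  \<comment> \<open>Zero is the empty sum, so preservation of finite sums includes preservation of
    zero.\<close>
  show ?thesis using rhom_finsum[OF assms, of "{}"] by simp
qed

lemma rhom_minus:
  assumes "right_module \<Lambda> M" "right_module \<Lambda> N" "h \<in> rhom \<Lambda> M N" "x \<in> carrier M"
  shows "h (\<ominus>\<^bsub>M\<^esub> x) = \<ominus>\<^bsub>N\<^esub> h x"
proof -
  interpret M: right_module \<Lambda> M by fact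
  interpret N: right_module \<Lambda> N by fact
  have "h (\<ominus>\<^bsub>M\<^esub> x) \<oplus>\<^bsub>N\<^esub> h x = \<zero>\<^bsub>N\<^esub>"
    using rhom_add[OF assms(3), of "\<ominus>\<^bsub>M\<^esub> x" x] rhom_zero[OF assms(1-3)] assms(4)
    by (simp add: M.M.l_neg)
  then show ?thesis
    using assms(4) by (intro N.M.minus_equality[symmetric]) (auto simp: rhom_closed[OF assms(3)])
qed

lemma rhom_inv_into:
  assumes M: "right_module \<Lambda> M" and h: "h \<in> rhom \<Lambda> M N"
    and bij: "bij_betw h (carrier M) (carrier N)"
  shows "inv_into (carrier M) h \<in> rhom \<Lambda> N M"
proof -
  interpret M: right_module \<Lambda> M by fact
  let ?k = "inv_into (carrier M) h"
  have k: "?k y \<in> carrier M" "h (?k y) = y" if "y \<in> carrier N" for y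
    using that bij by (auto simp: bij_betw_def inv_into_into f_inv_into_f)
  have kh: "?k (h x) = x" if "x \<in> carrier M" for x
    using that bij by (simp add: bij_betw_def inv_into_f_f)
  show ?thesis
  proof (rule rhomI)
    fix x y assume "x \<in> carrier N" "y \<in> carrier N"
    then show "?k (x \<oplus>\<^bsub>N\<^esub> y) = ?k x \<oplus>\<^bsub>M\<^esub> ?k y"
      using rhom_add[OF h, of "?k x" "?k y"] kh[of "?k x \<oplus>\<^bsub>M\<^esub> ?k y"] by (simp add: k)
  next
    fix x a assume "x \<in> carrier N" "a \<in> carrier \<Lambda>"
    then show "?k (x \<triangleleft>\<^bsub>N\<^esub> a) = ?k x \<triangleleft>\<^bsub>M\<^esub> a"
      using rhom_smult[OF h, of "?k x" a] kh[of "?k x \<triangleleft>\<^bsub>M\<^esub> a"] by (simp add: k M.rsmult_closed)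
  qed (use k in auto)
qed

lemma rsubmodule_image:
  assumes "right_module \<Lambda> M" "right_module \<Lambda> N" "h \<in> rhom \<Lambda> M N"
  shows "rsubmodule \<Lambda> (h ` carrier M) N"
proof -
  interpret M: right_module \<Lambda> M by fact
  interpret N: right_module \<Lambda> N by fact
  have "subgroup (h ` carrier M) (add_monoid N)"
  proof (rule group.subgroupI[OF N.M.a_group])
    fix a assume "a \<in> h ` carrier M"
    then show "inv\<^bsub>add_monoid N\<^esub> a \<in> h ` carrier M"
      using rhom_minus[OF assms]
      by (auto simp: a_inv_def[symmetric] intro!: image_eqI[of _ h "\<ominus>\<^bsub>M\<^esub> _"])
  next
    fix a b assume "a \<in> h ` carrier M" "b \<in> h ` carrier M"
    then show "a \<otimes>\<^bsub>add_monoid N\<^esub> b \<in> h ` carrier M"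
      by (auto simp: rhom_add[OF assms(3), symmetric])
  qed (use assms(3) in \<open>auto simp: rhom_closed\<close>)
  then show ?thesis
    unfolding rsubmodule_def by (auto simp: rhom_smult[OF assms(3), symmetric] M.rsmult_closed)
qed

lemma rker_add_image_eq_carrier:
  assumes P: "right_module \<Lambda> P" and L: "right_module \<Lambda> L"
    and p: "p \<in> rhom \<Lambda> P L" and h: "h \<in> rhom \<Lambda> N P"
    and eq: "\<And>x. x \<in> carrier P \<Longrightarrow> \<exists>y \<in> carrier N. p (h y) = p x"
  shows "rker P L p <+>\<^bsub>P\<^esub> h ` carrier N = carrier P"
proof -
  interpret P: right_module \<Lambda> P by fact
  interpret L: right_module \<Lambda> L by fact
  have "x \<in> rker P L p <+>\<^bsub>P\<^esub> h ` carrier N" if x: "x \<in> carrier P" for x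
  proof -
    obtain y where y: "y \<in> carrier N" "p (h y) = p x" using eq[OF x] by blast
    have hy: "h y \<in> carrier P" "p x \<in> carrier L"
      using y(1) x by (auto intro: rhom_closed[OF h] rhom_closed[OF p])
    have "p (x \<ominus>\<^bsub>P\<^esub> h y) = \<zero>\<^bsub>L\<^esub>"
      using x hy y(2) by (simp add: P.M.minus_eq rhom_add[OF p] rhom_minus[OF P L p] L.M.r_neg)
    then have "x \<ominus>\<^bsub>P\<^esub> h y \<in> rker P L p" using x hy by (simp add: rker_def)
    moreover have "x = (x \<ominus>\<^bsub>P\<^esub> h y) \<oplus>\<^bsub>P\<^esub> h y"
      using x hy by (simp add: P.M.minus_eq P.M.a_assoc P.M.l_neg)
    ultimately show ?thesis using y(1) by (auto simp: set_add_def')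
  qed
  then show ?thesis
    by (auto simp: set_add_def' rker_def rhom_closed[OF h])
qed

text \<open>The map \<open>\<tau>\<close> on the base is left general because two cases occur below:
  the identity of \<open>M\<close> under \<open>P0\<close>, and the restriction of an automorphism
  of \<open>P0\<close> to the kernel of \<open>\<sigma>\<close> under \<open>P1\<close>.\<close>

lemma projective_cover_endo_bij:
  assumes cov: "projective_cover \<Lambda> P p L" and a: "\<alpha> \<in> rhom \<Lambda> P P"
    and bij: "bij_betw \<tau> (carrier L) (carrier L)"
    and comm: "\<And>x. x \<in> carrier P \<Longrightarrow> p (\<alpha> x) = \<tau> (p x)"
  shows "bij_betw \<alpha> (carrier P) (carrier P)"
proof -
  have proj: "projective \<Lambda> P" and p: "p \<in> rhom \<Lambda> P L" "p ` carrier P = carrier L"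
    and sup: "\<And>H. \<lbrakk>rsubmodule \<Lambda> H P; rker P L p <+>\<^bsub>P\<^esub> H = carrier P\<rbrakk> \<Longrightarrow> H = carrier P"
    and fg: "fg_module \<Lambda> P" "fg_module \<Lambda> L"
    using cov by (auto simp: projective_cover_def superfluous_def projective_def)
  interpret P: right_module \<Lambda> P using fg(1) by (rule fg_right_module)
  interpret L: right_module \<Lambda> L using fg(2) by (rule fg_right_module)
  note rP = P.right_module_axioms and rL = L.right_module_axioms
  have surj: "\<alpha> ` carrier P = carrier P"
  proof (rule sup[OF rsubmodule_image[OF rP rP a] rker_add_image_eq_carrier[OF rP rL p(1) a]])
    fix x assume "x \<in> carrier P"
    \<comment> \<open>Both \<open>\<tau>\<close> and \<open>p\<close> are onto, so
      \<open>p x\<close> has the form \<open>\<tau> (p y)\<close>, which is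
      \<open>p (\<alpha> y)\<close>.\<close>
    then have "p x \<in> \<tau> ` p ` carrier P"
      using bij p(2) by (simp add: bij_betw_def rhom_closed[OF p(1)])
    then show "\<exists>y\<in>carrier P. p (\<alpha> y) = p x" by (auto simp: comm)
  qed
  have id: "(\<lambda>x. x) \<in> rhom \<Lambda> P P" by (rule rhomI) auto
  \<comment> \<open>Projectivity of \<open>P\<close> lifts the identity through the surjection
    \<open>\<alpha>\<close>; the lift \<open>s\<close> is a section.\<close>
  obtain s where s: "s \<in> rhom \<Lambda> P P" "\<And>x. x \<in> carrier P \<Longrightarrow> \<alpha> (s x) = x"
    using projective_lifting[OF proj fg(1) fg(1) a surj id] by blast
  have "s ` carrier P = carrier P"
  proof (rule sup[OF rsubmodule_image[OF rP rP s(1)]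
        rker_add_image_eq_carrier[OF rP rL p(1) s(1)]])
    \<comment> \<open>The witness is \<open>\<alpha> x\<close>: applying \<open>\<tau>\<close> to
      \<open>p (s (\<alpha> x))\<close> gives \<open>p (\<alpha> (s (\<alpha> x))) = p (\<alpha> x)
      = \<tau> (p x)\<close>, and \<open>\<tau>\<close> is injective.\<close>
    fix x assume x: "x \<in> carrier P"
    then have ax: "\<alpha> x \<in> carrier P" by (rule rhom_closed[OF a])
    moreover from ax have sax: "s (\<alpha> x) \<in> carrier P" by (rule rhom_closed[OF s(1)])
    then have "\<tau> (p (s (\<alpha> x))) = \<tau> (p x)" using x ax by (simp add: comm[symmetric] s(2))
    then have "p (s (\<alpha> x)) = p x"
      using bij x sax by (auto simp: bij_betw_def dest!: inj_onD intro: rhom_closed[OF p(1)])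
    ultimately show "\<exists>y\<in>carrier P. p (s y) = p x" by blast
  qed
  \<comment> \<open>Every element is now some \<open>s y\<close>, and \<open>\<alpha>\<close>
    recovers \<open>y\<close> from it.\<close>
  then have "inj_on \<alpha> (carrier P)"
    using s(2) by (metis (no_types, lifting) image_iff inj_onI)
  then show ?thesis using surj by (simp add: bij_betw_def)
qed

section \<open>Direct sums of finitely generated and of projective modules\<close>

lemma right_module_direct_sum:
  assumes "right_module \<Lambda> M" "right_module \<Lambda> N"
  shows "right_module \<Lambda> (M \<oplus>\<^sub>M N)"
proof -
  interpret M: right_module \<Lambda> M by fact
  interpret N: right_module \<Lambda> N by fact
  have "abelian_group (M \<oplus>\<^sub>M N)"
  proof (rule abelian_groupI)
    fix p assume "p \<in> carrier (M \<oplus>\<^sub>M N)"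
    then show "\<exists>q\<in>carrier (M \<oplus>\<^sub>M N). q \<oplus>\<^bsub>M \<oplus>\<^sub>M N\<^esub> p = \<zero>\<^bsub>M \<oplus>\<^sub>M N\<^esub>"
      by (intro bexI[of _ "(\<ominus>\<^bsub>M\<^esub> fst p, \<ominus>\<^bsub>N\<^esub> snd p)"])
        (auto simp: direct_sum_def M.M.l_neg N.M.l_neg)
  qed (auto simp: direct_sum_def M.M.add.m_ac N.M.add.m_ac)
  then show ?thesis
    by (intro right_module.intro right_module_axioms.intro M.L.ring_axioms)
      (auto simp: direct_sum_def M.rsmult_closed N.rsmult_closed M.rsmult_l_distr
        N.rsmult_l_distr M.rsmult_r_distr N.rsmult_r_distr M.rsmult_assoc N.rsmult_assoc
        M.rsmult_one N.rsmult_one)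
qed

lemma rhom_inl:
  assumes "right_module \<Lambda> N"
  shows "(\<lambda>x. (x, \<zero>\<^bsub>N\<^esub>)) \<in> rhom \<Lambda> M (M \<oplus>\<^sub>M N)"
proof -
  interpret N: right_module \<Lambda> N by fact
  show ?thesis by (rule rhomI) (auto simp: direct_sum_def)
qed

lemma rhom_inr:
  assumes "right_module \<Lambda> M"
  shows "(\<lambda>y. (\<zero>\<^bsub>M\<^esub>, y)) \<in> rhom \<Lambda> N (M \<oplus>\<^sub>M N)"
proof -
  interpret M: right_module \<Lambda> M by fact
  show ?thesis by (rule rhomI) (auto simp: direct_sum_def)
qed

lemma fg_module_direct_sum:
  fixes M :: "('m, 'r) rmodule" and N :: "('n, 'r) rmodule"
  assumes "fg_module \<Lambda> M" "fg_module \<Lambda> N"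
  shows "fg_module \<Lambda> (M \<oplus>\<^sub>M N)"
proof -
  interpret M: right_module \<Lambda> M using assms(1) by (rule fg_right_module)
  interpret N: right_module \<Lambda> N using assms(2) by (rule fg_right_module)
  interpret S: right_module \<Lambda> "M \<oplus>\<^sub>M N"
    by (rule right_module_direct_sum[OF M.right_module_axioms N.right_module_axioms])
  obtain A where A: "finite A" "A \<subseteq> carrier M"
    and genA: "\<And>x. x \<in> carrier M \<Longrightarrow> \<exists>c \<in> A \<rightarrow> carrier \<Lambda>. x = (\<Oplus>\<^bsub>M\<^esub>a\<in>A. a \<triangleleft>\<^bsub>M\<^esub> c a)"
    using assms(1) unfolding fg_module_def by blast
  obtain B where B: "finite B" "B \<subseteq> carrier N"
    and genB: "\<And>y. y \<in> carrier N \<Longrightarrow> \<exists>d \<in> B \<rightarrow> carrier \<Lambda>. y = (\<Oplus>\<^bsub>N\<^esub>b\<in>B. b \<triangleleft>\<^bsub>N\<^esub> d b)"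
    using assms(2) unfolding fg_module_def by blast
  let ?i = "\<lambda>x. (x, \<zero>\<^bsub>N\<^esub>) :: 'm \<times> 'n" and ?j = "\<lambda>y. (\<zero>\<^bsub>M\<^esub>, y) :: 'm \<times> 'n"
  note i = rhom_inl[OF N.right_module_axioms, of M]
  note j = rhom_inr[OF M.right_module_axioms, of N]
  let ?B = "B - {\<zero>\<^bsub>N\<^esub>}" \<comment> \<open>keeps the two families of generators disjoint\<close>
  let ?S = "?i ` A \<union> ?j ` ?B"
  have "\<exists>e \<in> ?S \<rightarrow> carrier \<Lambda>. p = (\<Oplus>\<^bsub>M \<oplus>\<^sub>M N\<^esub>s\<in>?S. s \<triangleleft>\<^bsub>M \<oplus>\<^sub>M N\<^esub> e s)"
    if mem: "p \<in> carrier (M \<oplus>\<^sub>M N)" for p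
  proof -
    obtain x y where p: "p = (x, y)" "x \<in> carrier M" "y \<in> carrier N"
      using mem by (auto simp: direct_sum_def)
    obtain c where c: "c \<in> A \<rightarrow> carrier \<Lambda>" "x = (\<Oplus>\<^bsub>M\<^esub>a\<in>A. a \<triangleleft>\<^bsub>M\<^esub> c a)"
      using genA[OF p(2)] by blast
    obtain d where d: "d \<in> B \<rightarrow> carrier \<Lambda>" "y = (\<Oplus>\<^bsub>N\<^esub>b\<in>B. b \<triangleleft>\<^bsub>N\<^esub> d b)"
      using genB[OF p(3)] by blast
    \<comment> \<open>Discarding the generator zero changes nothing: its term is zero times a
      scalar.\<close>
    have y: "y = (\<Oplus>\<^bsub>N\<^esub>b\<in>?B. b \<triangleleft>\<^bsub>N\<^esub> d b)"
      unfolding d(2) using B d(1)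
      by (intro N.M.add.finprod_mono_neutral_cong_right) (auto simp: Pi_iff intro!: N.rsmult_closed)
    \<comment> \<open>One coefficient function has to serve both families. A zero second component
      marks the elements coming from \<open>A\<close>, since the zero of \<open>N\<close> was
      removed from \<open>B\<close>.\<close>
    define e where "e s = (if snd s = \<zero>\<^bsub>N\<^esub> then c (fst s) else d (snd s))" for s
    have e: "e \<in> ?S \<rightarrow> carrier \<Lambda>" using c(1) d(1) by (auto simp: e_def Pi_iff)
    have memA: "a \<in> carrier M" "c a \<in> carrier \<Lambda>" if "a \<in> A" for a
      using that A(2) c(1) by auto
    have memB: "b \<in> carrier N" "d b \<in> carrier \<Lambda>" if "b \<in> B" for b
      using that B(2) d(1) by auto
    have clA: "a \<triangleleft>\<^bsub>M\<^esub> c a \<in> carrier M" if "a \<in> A" for a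
      by (intro M.rsmult_closed memA that)
    have clB: "b \<triangleleft>\<^bsub>N\<^esub> d b \<in> carrier N" if "b \<in> B" for b
      by (intro N.rsmult_closed memB that)
    have eA: "?i a \<triangleleft>\<^bsub>M \<oplus>\<^sub>M N\<^esub> e (?i a) = ?i (a \<triangleleft>\<^bsub>M\<^esub> c a)" if "a \<in> A" for a
      using rhom_smult[OF i memA[OF that]] by (simp add: e_def)
    have eB: "?j b \<triangleleft>\<^bsub>M \<oplus>\<^sub>M N\<^esub> e (?j b) = ?j (b \<triangleleft>\<^bsub>N\<^esub> d b)" if "b \<in> ?B" for b
      using rhom_smult[OF j memB] that by (simp add: e_def)
    have Scl: "(\<lambda>s. s \<triangleleft>\<^bsub>M \<oplus>\<^sub>M N\<^esub> e s) \<in> ?S \<rightarrow> carrier (M \<oplus>\<^sub>M N)"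
    proof (rule Pi_I)
      fix s assume "s \<in> ?S"
      then consider a where "a \<in> A" "s = ?i a" | b where "b \<in> ?B" "s = ?j b" by blast
      then show "s \<triangleleft>\<^bsub>M \<oplus>\<^sub>M N\<^esub> e s \<in> carrier (M \<oplus>\<^sub>M N)"
        using rhom_closed[OF i clA] rhom_closed[OF j clB] by cases (simp_all add: eA eB)
    qed
    \<comment> \<open>Over each family the sum is reindexed along the injective inclusion, which is
      then pulled out of the sum as a homomorphism.\<close>
    have sA: "(\<Oplus>\<^bsub>M \<oplus>\<^sub>M N\<^esub>s\<in>?i ` A. s \<triangleleft>\<^bsub>M \<oplus>\<^sub>M N\<^esub> e s) = ?i x"
    proof -
      have "(\<Oplus>\<^bsub>M \<oplus>\<^sub>M N\<^esub>s\<in>?i ` A. s \<triangleleft>\<^bsub>M \<oplus>\<^sub>M N\<^esub> e s)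
          = (\<Oplus>\<^bsub>M \<oplus>\<^sub>M N\<^esub>a\<in>A. ?i a \<triangleleft>\<^bsub>M \<oplus>\<^sub>M N\<^esub> e (?i a))"
        using Scl by (intro S.M.finsum_reindex) (auto simp: inj_on_def)
      also have "\<dots> = (\<Oplus>\<^bsub>M \<oplus>\<^sub>M N\<^esub>a\<in>A. ?i (a \<triangleleft>\<^bsub>M\<^esub> c a))"
        by (intro S.M.finsum_cong') (use rhom_closed[OF i clA] eA in auto)
      also have "\<dots> = ?i x"
        unfolding c(2) using clA A(1)
        by (intro rhom_finsum[OF M.right_module_axioms S.right_module_axioms i, symmetric]) auto
      finally show ?thesis .
    qed
    have sB: "(\<Oplus>\<^bsub>M \<oplus>\<^sub>M N\<^esub>s\<in>?j ` ?B. s \<triangleleft>\<^bsub>M \<oplus>\<^sub>M N\<^esub> e s) = ?j y"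
    proof -
      have "(\<Oplus>\<^bsub>M \<oplus>\<^sub>M N\<^esub>s\<in>?j ` ?B. s \<triangleleft>\<^bsub>M \<oplus>\<^sub>M N\<^esub> e s)
          = (\<Oplus>\<^bsub>M \<oplus>\<^sub>M N\<^esub>b\<in>?B. ?j b \<triangleleft>\<^bsub>M \<oplus>\<^sub>M N\<^esub> e (?j b))"
        using Scl by (intro S.M.finsum_reindex) (auto simp: inj_on_def)
      also have "\<dots> = (\<Oplus>\<^bsub>M \<oplus>\<^sub>M N\<^esub>b\<in>?B. ?j (b \<triangleleft>\<^bsub>N\<^esub> d b))"
        by (intro S.M.finsum_cong') (use rhom_closed[OF j clB] eB in auto)
      also have "\<dots> = ?j y"
        unfolding y using clB B(1)
        by (intro rhom_finsum[OF N.right_module_axioms S.right_module_axioms j, symmetric]) auto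
      finally show ?thesis .
    qed
    have "(\<Oplus>\<^bsub>M \<oplus>\<^sub>M N\<^esub>s\<in>?S. s \<triangleleft>\<^bsub>M \<oplus>\<^sub>M N\<^esub> e s) = ?i x \<oplus>\<^bsub>M \<oplus>\<^sub>M N\<^esub> ?j y"
      unfolding sA[symmetric] sB[symmetric] using A(1) B(1) Scl
      by (intro S.M.finsum_Un_disjoint) auto
    also have "\<dots> = p" using p by (simp add: direct_sum_def)
    finally show ?thesis using e by auto
  qed
  moreover have "finite ?S" "?S \<subseteq> carrier (M \<oplus>\<^sub>M N)"
    using A B by (auto simp: direct_sum_def)
  ultimately show ?thesis
    unfolding fg_module_def using S.right_module_axioms by blast
qed

text \<open>The restrictions of \<open>h\<close> to the two summands lift separately, and the row of
  the two lifts is a lift of \<open>h\<close>.\<close>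

lemma projective_direct_sum:
  fixes \<Lambda> :: "('r, 'y) ring_scheme" and P :: "('m, 'r) rmodule" and Q :: "('n, 'r) rmodule"
  assumes P: "projective \<Lambda> P" and Q: "projective \<Lambda> Q"
  shows "projective \<Lambda> (P \<oplus>\<^sub>M Q)"
  unfolding projective_def
proof (intro conjI allI impI)
  show "fg_module \<Lambda> (P \<oplus>\<^sub>M Q)"
    using P Q by (intro fg_module_direct_sum projective_fg)
  fix N L :: "((nat \<Rightarrow> 'r) set, 'r) rmodule" and p h
  assume N: "fg_module \<Lambda> N" and L: "fg_module \<Lambda> L" and p: "p \<in> rhom \<Lambda> N L"
    and surj: "p ` carrier N = carrier L" and h: "h \<in> rhom \<Lambda> (P \<oplus>\<^sub>M Q) L"
  interpret P: right_module \<Lambda> P by (intro fg_right_module projective_fg P)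
  interpret Q: right_module \<Lambda> Q by (intro fg_right_module projective_fg Q)
  interpret N: right_module \<Lambda> N by (rule fg_right_module[OF N])
  obtain k where k: "k \<in> rhom \<Lambda> P N" "\<And>x. x \<in> carrier P \<Longrightarrow> p (k x) = h (x, \<zero>\<^bsub>Q\<^esub>)"
    using projective_lifting[OF P N L p surj
        rhom_compose[OF rhom_inl[OF Q.right_module_axioms] h]] by blast
  obtain l where l: "l \<in> rhom \<Lambda> Q N" "\<And>x. x \<in> carrier Q \<Longrightarrow> p (l x) = h (\<zero>\<^bsub>P\<^esub>, x)"
    using projective_lifting[OF Q N L p surj
        rhom_compose[OF rhom_inr[OF P.right_module_axioms] h]] by blast
  show "\<exists>k\<in>rhom \<Lambda> (P \<oplus>\<^sub>M Q) N. \<forall>x\<in>carrier (P \<oplus>\<^sub>M Q). p (k x) = h x"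
  proof (intro bexI ballI)
    show "row N k l \<in> rhom \<Lambda> (P \<oplus>\<^sub>M Q) N" by (rule N.rhom_row[OF k(1) l(1)])
    fix z assume "z \<in> carrier (P \<oplus>\<^sub>M Q)"
    then obtain x y where z: "z = (x, y)" "x \<in> carrier P" "y \<in> carrier Q"
      by (auto simp: direct_sum_def)
    have "p (row N k l z) = h (x, \<zero>\<^bsub>Q\<^esub>) \<oplus>\<^bsub>L\<^esub> h (\<zero>\<^bsub>P\<^esub>, y)"
      using z by (simp add: row_def rhom_add[OF p] rhom_closed[OF k(1)] rhom_closed[OF l(1)] k(2) l(2))
    also have "\<dots> = h z"
      using z rhom_add[OF h, of "(x, \<zero>\<^bsub>Q\<^esub>)" "(\<zero>\<^bsub>P\<^esub>, y)"] by (simp add: direct_sum_def)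
    finally show "p (row N k l z) = h z" .
  qed
qed

section \<open>Automorphisms in the morphism category\<close>

lemma H_automorphism_bij:
  assumes X: "H_obj \<Lambda> X" and \<gamma>: "(s, t) \<in> H_hom \<Lambda> X X"
    and s: "bij_betw s (carrier (src X)) (carrier (src X))"
    and t: "bij_betw t (carrier (tgt X)) (carrier (tgt X))"
  shows "H_automorphism \<Lambda> X (s, t)"
proof -
  let ?s = "inv_into (carrier (src X)) s" and ?t = "inv_into (carrier (tgt X)) t"
  have hom: "s \<in> rhom \<Lambda> (src X) (src X)" "t \<in> rhom \<Lambda> (tgt X) (tgt X)"
    and comm: "\<And>x. x \<in> carrier (src X) \<Longrightarrow> t (arr X x) = arr X (s x)"
    and arr: "\<And>x. x \<in> carrier (src X) \<Longrightarrow> arr X x \<in> carrier (tgt X)"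
    and rm: "right_module \<Lambda> (src X)" "right_module \<Lambda> (tgt X)"
    using X \<gamma> by (auto simp: H_hom_def H_obj_def fg_module_def rhom_closed)
  have S: "?s x \<in> carrier (src X)" "s (?s x) = x" "?s (s x) = x" if "x \<in> carrier (src X)" for x
    using that s by (auto simp: bij_betw_def inv_into_into f_inv_into_f inv_into_f_f)
  have T: "t (?t x) = x" "?t (t x) = x" if "x \<in> carrier (tgt X)" for x
    using that t by (auto simp: bij_betw_def f_inv_into_f inv_into_f_f)
  \<comment> \<open>The componentwise inverses form a morphism: the square of \<open>(s, t)\<close>
    at \<open>?s x\<close> reads \<open>t (arr X (?s x)) = arr X x\<close>, and applying
    \<open>?t\<close> gives the claim.\<close>
  have "?t (arr X x) = arr X (?s x)" if x: "x \<in> carrier (src X)" for x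
    using T(2)[OF arr[OF S(1)[OF x]]] comm[OF S(1)[OF x]] S(2)[OF x] by simp
  then have "(?s, ?t) \<in> H_hom \<Lambda> X X"
    using rhom_inv_into[OF rm(1) hom(1) s] rhom_inv_into[OF rm(2) hom(2) t]
    by (simp add: H_hom_def)
  then show ?thesis
    unfolding H_automorphism_def using \<gamma> S T
    by (intro conjI bexI[of _ "(?s, ?t)"]) (auto simp: H_eq_def H_comp_def H_id_def)
qed

section \<open>The approximation property and minimality\<close>

theorem proposition3p4:
  fixes R :: "('k, 'x) ring_scheme"
    and \<Lambda> :: "('k, 'r, 'y) module_scheme"
    and M :: "('m, 'r) rmodule"
    and Q :: "('q, 'r) rmodule"
    and P1 :: "('p1, 'r) rmodule"
    and P0 :: "('p0, 'r) rmodule"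
  assumes "artin_algebra R \<Lambda>"
    and "fg_module \<Lambda> M"
    and "projective_cover \<Lambda> Q g M"
    and "minimal_projective_presentation \<Lambda> P1 f P0 \<sigma> M"
    and "g' \<in> rhom \<Lambda> Q P0"
    and "\<forall>x \<in> carrier Q. \<sigma> (g' x) = g x"
  shows "minimal_right_P_approximation TYPE('u) TYPE('v) \<Lambda>
           \<lparr>src = P1 \<oplus>\<^sub>M Q, tgt = P0, arr = row P0 f g'\<rparr>
           (row Q (\<lambda>_. \<zero>\<^bsub>Q\<^esub>) id, \<sigma>)
           \<lparr>src = Q, tgt = M, arr = g\<rparr>"
proof -
  \<comment> \<open>The kernel of \<open>\<sigma>\<close> as a module with the operations of
    \<open>P0\<close>. Homomorphisms into it are those into \<open>P0\<close> whose values lie in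
    the kernel, so \<open>f\<close> can be read with either target.\<close>
  let ?K = "P0\<lparr>carrier := rker P0 M \<sigma>\<rparr>"
  let ?P = "\<lparr>src = P1 \<oplus>\<^sub>M Q, tgt = P0, arr = row P0 f g'\<rparr>"
  let ?X = "\<lparr>src = Q, tgt = M, arr = g\<rparr>"
  let ?\<theta> = "(row Q (\<lambda>_. \<zero>\<^bsub>Q\<^esub>) id, \<sigma>)"
  have covQ: "projective \<Lambda> Q" "g \<in> rhom \<Lambda> Q M"
    using assms(3) by (auto simp: projective_cover_def)
  have cov0: "projective_cover \<Lambda> P0 \<sigma> M" and cov1: "projective_cover \<Lambda> P1 f ?K"
    using assms(4) by (auto simp: minimal_projective_presentation_def)
  then have p0: "projective \<Lambda> P0" "\<sigma> \<in> rhom \<Lambda> P0 M" "\<sigma> ` carrier P0 = carrier M"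
    and p1: "projective \<Lambda> P1" "f \<in> rhom \<Lambda> P1 ?K" "f ` carrier P1 = carrier ?K"
    and fgK: "fg_module \<Lambda> ?K"
    by (auto simp: projective_cover_def)
  note fg = assms(2) covQ(1)[THEN projective_fg] p0(1)[THEN projective_fg]
    p1(1)[THEN projective_fg]
  interpret M: right_module \<Lambda> M by (rule fg_right_module[OF fg(1)])
  interpret Q: right_module \<Lambda> Q by (rule fg_right_module[OF fg(2)])
  interpret P0: right_module \<Lambda> P0 by (rule fg_right_module[OF fg(3)])
  interpret P1: right_module \<Lambda> P1 by (rule fg_right_module[OF fg(4)])
  note rm = M.right_module_axioms Q.right_module_axioms P0.right_module_axioms
    P1.right_module_axioms
  note g' = assms(5) and \<sigma>g' = assms(6)[rule_format]
  have f: "f \<in> rhom \<Lambda> P1 P0" using p1(2) by (auto simp: rhom_def rker_def)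
  have \<sigma>f: "\<sigma> (f x) = \<zero>\<^bsub>M\<^esub>" if "x \<in> carrier P1" for x
    using rhom_closed[OF p1(2) that] by (simp add: rker_def)
  note cl [simp] = rhom_closed[OF f] rhom_closed[OF g'] rhom_closed[OF p0(2)]
    rhom_closed[OF covQ(2)]
  have X: "H_obj \<Lambda> ?X" using fg covQ by (simp add: H_obj_def)
  have P: "P_obj \<Lambda> ?P"
    using projective_direct_sum[OF p1(1) covQ(1)] p0(1) P0.rhom_row[OF f g'] fg(3)
    by (simp add: P_obj_def H_obj_def projective_fg)
  have row0: "row Q (\<lambda>_. \<zero>\<^bsub>Q\<^esub>) id p = snd p" if "p \<in> carrier (P1 \<oplus>\<^sub>M Q)" for p
    using that by (auto simp: row_def direct_sum_def)
  have "row Q (\<lambda>_. \<zero>\<^bsub>Q\<^esub>) id \<in> rhom \<Lambda> (P1 \<oplus>\<^sub>M Q) Q"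
    by (rule Q.rhom_row) (auto intro!: rhomI)
  moreover have "\<sigma> (row P0 f g' p) = g (row Q (\<lambda>_. \<zero>\<^bsub>Q\<^esub>) id p)"
    if "p \<in> carrier (P1 \<oplus>\<^sub>M Q)" for p
    using that by (auto simp: row_def direct_sum_def rhom_add[OF p0(2)] \<sigma>f \<sigma>g')
  ultimately have \<theta>: "?\<theta> \<in> H_hom \<Lambda> ?P ?X"
    using p0(2) by (simp add: H_hom_def)
  have lift: "\<exists>\<psi> \<in> H_hom \<Lambda> Y ?P. H_eq Y (?\<theta> \<circ>\<^sub>H \<psi>) \<phi>"
    if Y: "P_obj \<Lambda> Y" and \<phi>: "\<phi> \<in> H_hom \<Lambda> Y ?X" for Y :: "('u, 'v, 'r) arrow" and \<phi>
  proof -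
    obtain s t where \<phi>_eq: "\<phi> = (s, t)" by (cases \<phi>)
    let ?A = "src Y" and ?B = "tgt Y" and ?a = "arr Y"
    have A: "projective \<Lambda> ?A" and B: "projective \<Lambda> ?B" and a: "?a \<in> rhom \<Lambda> ?A ?B"
      using Y by (auto simp: P_obj_def H_obj_def)
    have s: "s \<in> rhom \<Lambda> ?A Q" and t: "t \<in> rhom \<Lambda> ?B M"
      and comm: "\<And>x. x \<in> carrier ?A \<Longrightarrow> t (?a x) = g (s x)"
      using \<phi> by (auto simp: \<phi>_eq H_hom_def)
    obtain t' where t': "t' \<in> rhom \<Lambda> ?B P0" "\<And>x. x \<in> carrier ?B \<Longrightarrow> \<sigma> (t' x) = t x"
      using projective_lifting[OF B fg(3,1) p0(2,3) t] by blast
    note cl' [simp] = rhom_closed[OF a] rhom_closed[OF s] rhom_closed[OF t]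
      rhom_closed[OF t'(1)]
    \<comment> \<open>The defect of the square formed with the lift \<open>t'\<close>. It is killed
      by \<open>\<sigma>\<close>, because \<open>\<sigma> t' a = t a = g s = \<sigma> g' s\<close>,
      where \<open>a\<close> is the structure map of \<open>Y\<close>.\<close>
    let ?d = "\<lambda>x. t' (?a x) \<ominus>\<^bsub>P0\<^esub> g' (s x)"
    have d: "?d \<in> rhom \<Lambda> ?A P0"
      by (intro P0.rhom_diff rhom_compose[OF a t'(1)] rhom_compose[OF s g'])
    have "\<sigma> (?d x) = \<zero>\<^bsub>M\<^esub>" if "x \<in> carrier ?A" for x
      using that
      by (simp add: P0.M.minus_eq rhom_add[OF p0(2)] rhom_minus[OF rm(3,1) p0(2)] t'(2) \<sigma>g'
          comm M.M.r_neg)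
    then have "?d \<in> rhom \<Lambda> ?A ?K"
      using d by (auto simp: rhom_def rker_def)
    \<comment> \<open>As a map into \<open>?K\<close>, the defect lifts through the surjection
      \<open>f\<close>, since the source of \<open>Y\<close> is projective.\<close>
    then obtain u where u: "u \<in> rhom \<Lambda> ?A P1" "\<And>x. x \<in> carrier ?A \<Longrightarrow> f (u x) = ?d x"
      using projective_lifting[OF A fg(4) fgK p1(2,3)] by blast
    have us: "(\<lambda>x. (u x, s x)) \<in> rhom \<Lambda> ?A (P1 \<oplus>\<^sub>M Q)"
      using u(1) s by (auto simp: rhom_def direct_sum_def)
    \<comment> \<open>Adding \<open>g' (s x)\<close> to \<open>f (u x)\<close> restores
      \<open>t' (?a x)\<close>, so the first component \<open>u\<close> repairs the square.\<close>
    have "t' (?a x) = row P0 f g' (u x, s x)" if "x \<in> carrier ?A" for x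
      using that by (simp add: row_def u(2) P0.M.minus_eq P0.M.a_assoc P0.M.l_neg)
    then have "(\<lambda>x. (u x, s x), t') \<in> H_hom \<Lambda> Y ?P"
      using us t'(1) by (simp add: H_hom_def)
    moreover have "H_eq Y (?\<theta> \<circ>\<^sub>H (\<lambda>x. (u x, s x), t')) \<phi>"
      using t'(2) row0[OF rhom_closed[OF us]] by (simp add: H_eq_def H_comp_def \<phi>_eq)
    ultimately show ?thesis by blast
  qed
  have auto: "H_automorphism \<Lambda> ?P \<gamma>"
    if \<gamma>: "\<gamma> \<in> H_hom \<Lambda> ?P ?P" and eq: "H_eq ?P (?\<theta> \<circ>\<^sub>H \<gamma>) ?\<theta>" for \<gamma>
  proof -
    obtain s t where \<gamma>_eq: "\<gamma> = (s, t)" by (cases \<gamma>)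
    let ?D = "P1 \<oplus>\<^sub>M Q"
    have s: "s \<in> rhom \<Lambda> ?D ?D" and t: "t \<in> rhom \<Lambda> P0 P0"
      and comm: "\<And>p. p \<in> carrier ?D \<Longrightarrow> t (row P0 f g' p) = row P0 f g' (s p)"
      using \<gamma> by (auto simp: \<gamma>_eq H_hom_def)
    have \<sigma>t: "\<sigma> (t x) = \<sigma> x" if "x \<in> carrier P0" for x
      using eq that by (simp add: \<gamma>_eq H_eq_def H_comp_def)
    have snd_s: "snd (s p) = snd p" if "p \<in> carrier ?D" for p
      using eq that row0[OF that] row0[OF rhom_closed[OF s that]]
      by (simp add: \<gamma>_eq H_eq_def H_comp_def)
    have bt: "bij_betw t (carrier P0) (carrier P0)"
      by (rule projective_cover_endo_bij[OF cov0 t, of id]) (auto simp: \<sigma>t)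
    have btK: "bij_betw t (carrier ?K) (carrier ?K)"
      unfolding bij_betw_def
    proof
      show "inj_on t (carrier ?K)"
        using bt by (auto simp: bij_betw_def rker_def inj_on_def)
      \<comment> \<open>A preimage \<open>x\<close> of \<open>y\<close> under \<open>t\<close> is
        itself in the kernel, because
        \<open>\<sigma> x = \<sigma> (t x) = \<sigma> y = 0\<close>.\<close>
      have "y \<in> t ` rker P0 M \<sigma>" if y: "y \<in> rker P0 M \<sigma>" for y
      proof -
        obtain x where "x \<in> carrier P0" "y = t x"
          using bt y by (auto simp: bij_betw_def rker_def)
        then show ?thesis using y by (auto simp: rker_def \<sigma>t)
      qed
      then show "t ` carrier ?K = carrier ?K"
        by (auto simp: rker_def \<sigma>t rhom_closed[OF t])
    qed
    \<comment> \<open>The upper left entry of the matrix of \<open>s\<close>. The lower left entry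
      vanishes because \<open>s\<close> preserves second components.\<close>
    define \<alpha> where "\<alpha> x = fst (s (x, \<zero>\<^bsub>Q\<^esub>))" for x
    have fst: "fst \<in> rhom \<Lambda> ?D P1" by (auto simp: rhom_def direct_sum_def)
    have \<alpha>: "\<alpha> \<in> rhom \<Lambda> P1 P1"
      unfolding \<alpha>_def[abs_def]
      by (rule rhom_compose[OF rhom_compose[OF rhom_inl[OF rm(2)] s] fst])
    have inl: "(x, \<zero>\<^bsub>Q\<^esub>) \<in> carrier ?D" "s (x, \<zero>\<^bsub>Q\<^esub>) = (\<alpha> x, \<zero>\<^bsub>Q\<^esub>)" if "x \<in> carrier P1" for x
      using that snd_s[of "(x, \<zero>\<^bsub>Q\<^esub>)"]
      by (auto simp: \<alpha>_def direct_sum_def prod_eq_iff)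
    \<comment> \<open>This is the square of \<open>(s, t)\<close> evaluated at
      \<open>(x, 0)\<close>, where the summand \<open>g' 0\<close> vanishes on both sides.\<close>
    have f\<alpha>: "f (\<alpha> x) = t (f x)" if x: "x \<in> carrier P1" for x
      using comm[OF inl(1)[OF x]] x
      by (simp add: inl(2) row_def rhom_zero[OF rm(2,3) g'] rhom_closed[OF \<alpha>])
    have b\<alpha>: "bij_betw \<alpha> (carrier P1) (carrier P1)"
      by (rule projective_cover_endo_bij[OF cov1 \<alpha> btK]) (rule f\<alpha>)
    \<comment> \<open>The off-diagonal entry: \<open>s\<close> has rows
      \<open>[\<alpha> \<beta>]\<close> and \<open>[0 1]\<close>.\<close>
    define \<beta> where "\<beta> y = fst (s (\<zero>\<^bsub>P1\<^esub>, y))" for y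
    have s_eq: "s (x, y) = (\<alpha> x \<oplus>\<^bsub>P1\<^esub> \<beta> y, y)" and \<beta>: "\<beta> y \<in> carrier P1"
      if xy: "x \<in> carrier P1" "y \<in> carrier Q" for x y
    proof -
      have in2: "(\<zero>\<^bsub>P1\<^esub>, y) \<in> carrier ?D" using xy by (simp add: direct_sum_def)
      show "\<beta> y \<in> carrier P1"
        unfolding \<beta>_def by (rule rhom_closed[OF fst rhom_closed[OF s in2]])
      have "s (\<zero>\<^bsub>P1\<^esub>, y) = (\<beta> y, y)"
        using snd_s[OF in2] by (simp add: \<beta>_def prod_eq_iff)
      moreover have "(x, y) = (x, \<zero>\<^bsub>Q\<^esub>) \<oplus>\<^bsub>?D\<^esub> (\<zero>\<^bsub>P1\<^esub>, y)"
        using xy by (simp add: direct_sum_def)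
      ultimately show "s (x, y) = (\<alpha> x \<oplus>\<^bsub>P1\<^esub> \<beta> y, y)"
        using xy rhom_add[OF s inl(1)[OF xy(1)] in2] inl(2)[OF xy(1)]
        by (simp add: direct_sum_def)
    qed
    have "bij_betw s (carrier ?D) (carrier ?D)"
      unfolding bij_betw_def
    proof
      \<comment> \<open>Equal images under \<open>s\<close> have the same second component
        \<open>y\<close>, so \<open>\<beta> y\<close> cancels and injectivity of
        \<open>\<alpha>\<close> finishes.\<close>
      have "x = x'" if "x \<in> carrier P1" "x' \<in> carrier P1" "y \<in> carrier Q"
        "\<alpha> x \<oplus>\<^bsub>P1\<^esub> \<beta> y = \<alpha> x' \<oplus>\<^bsub>P1\<^esub> \<beta> y" for x x' y
        using that b\<alpha> \<beta>[of x y] rhom_closed[OF \<alpha>]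
        by (auto simp: bij_betw_def dest: inj_onD)
      then show "inj_on s (carrier ?D)"
        by (auto simp: inj_on_def direct_sum_def s_eq)
      have "(x, y) \<in> s ` carrier ?D" if xy: "x \<in> carrier P1" "y \<in> carrier Q" for x y
      proof -
        \<comment> \<open>Back substitution in the triangular system: the preimage is
          \<open>(z, y)\<close> with \<open>\<alpha> z = x - \<beta> y\<close>.\<close>
        have "x \<ominus>\<^bsub>P1\<^esub> \<beta> y \<in> \<alpha> ` carrier P1"
          using b\<alpha> xy \<beta>[OF xy] by (simp add: bij_betw_def)
        then obtain z where z: "z \<in> carrier P1" "\<alpha> z = x \<ominus>\<^bsub>P1\<^esub> \<beta> y" by auto
        then have "s (z, y) = (x, y)"
          using xy \<beta>[OF xy] by (simp add: s_eq P1.M.minus_eq P1.M.a_assoc P1.M.l_neg)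
        moreover have "(z, y) \<in> carrier ?D" using z xy by (simp add: direct_sum_def)
        ultimately show ?thesis by (metis image_eqI)
      qed
      then have "carrier ?D \<subseteq> s ` carrier ?D" by (auto simp: direct_sum_def)
      then show "s ` carrier ?D = carrier ?D" using rhom_closed[OF s] by blast
    qed
    then show ?thesis
      using H_automorphism_bij[of \<Lambda> ?P s t] P \<gamma> bt by (simp add: \<gamma>_eq P_obj_def)
  qed
  show ?thesis
    unfolding minimal_right_P_approximation_def right_P_approximation_def
    using X P \<theta> lift auto by blast
qed

end
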